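(* Let $G$ be a full DAG and let $X$ be a set of routes in $G$. Then there exists an ample framing $F$ of $G$ whose set of exceptional routes is exactly $X$ if and only if every edge of $G$ is contained in a unique route in $X$ and the adjacency graph $\mathrm{Adj}(G,X)$ is bipartite.
   Context: A DAG is a finite directed acyclic graph, possibly with multiple edges. For a vertex $v$, $\mathrm{in}(v)$ and $\mathrm{out}(v)$ are its sets of incoming and outgoing edges; $v$ is a source if $\mathrm{in}(v)=\emptyset$, a sink if $\mathrm{out}(v)=\emptyset$, and an inner vertex otherwise. An inner vertex $v$ is full if $|\mathrm{in}(v)|=|\mathrm{out}(v)|=2$; $G$ is full if every inner vertex is full. An edge is idle if it is the only incoming or only outgoing edge of some inner vertex. A route is a maximal directed path (source to sink). A framing $F$ assigns to each inner vertex $v$ a linear order $\prec$ on $\mathrm{in}(v)$ and one on $\mathrm{out}(v)$. For inner $v$, $\mathrm{In}(v)$ (resp. $\mathrm{Out}(v)$) is the set of directed paths from a source to $v$ (resp. from $v$ to a sink). For distinct $P,Q\in\mathrm{Out}(v)$, let $w$ be the last vertex of their maximal common initial segment and $e_P\ne e_Q$ the edges of $P,Q$ leaving $w$; $P\prec Q$ iff $e_P\prec e_Q$ in $\mathrm{out}(w)$; analogously for $\mathrm{In}(v)$ using the first vertex $w$ of the maximal common final segment and the edges entering $w$, compared in $\mathrm{in}(w)$. For a route $R$ through $v$, $Rv$ is its part from the source to $v$ and $vR$ its part from $v$ to the sink. Routes $P,Q$ through a common inner vertex $v$ are in conflict at $v$ if, after possibly swapping them, $Pv\prec Qv$ and $vQ\prec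 vP$; otherwise coherent at $v$; they are coherent if coherent at every common inner vertex. A route is exceptional if coherent with every route. The flow cone $\mathcal{F}_+(G)\subset\mathbb{R}^{E(G)}$ consists of $f\ge 0$ with flow conservation at every inner vertex; $v_R$ is the indicator vector of the edges of route $R$. $F$ is ample if $\{v_R: R\text{ exceptional}\}$ lies in no facet of $\mathcal{F}_+(G)$ (equivalently, by Danilov–Karzanov–Koshevoy, every non-idle edge lies on an exceptional route). The adjacency graph $\mathrm{Adj}(G,X)$ has vertex set $X$, with distinct routes $R,S\in X$ adjacent iff some full vertex lies on both $R$ and $S$. *)

theory Defs
  imports "HOL-Analysis.Analysis" "Graph_Theory.Graph_Theory"
begin

locale dag = fin_digraph +
  assumes acyclic: "\<nexists>c. cycle c"

definition source :: "('v, 'e) pre_digraph \<Rightarrow> 'v \<Rightarrow> bool" where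
  "source G v \<longleftrightarrow> v \<in> verts G \<and> in_arcs G v = {}"

definition sink :: "('v, 'e) pre_digraph \<Rightarrow> 'v \<Rightarrow> bool" where
  "sink G v \<longleftrightarrow> v \<in> verts G \<and> out_arcs G v = {}"

definition inner :: "('v, 'e) pre_digraph \<Rightarrow> 'v \<Rightarrow> bool" where
  "inner G v \<longleftrightarrow> v \<in> verts G \<and> \<not> source G v \<and> \<not> sink G v"

definition full_vertex :: "('v, 'e) pre_digraph \<Rightarrow> 'v \<Rightarrow> bool" where
  "full_vertex G v \<longleftrightarrow> inner G v \<and> in_degree G v = 2 \<and> out_degree G v = 2"

definition full :: "('v, 'e) pre_digraph \<Rightarrow> bool" where
  "full G \<longleftrightarrow> (\<forall>v. inner G v \<longrightarrow> full_vertex G v)"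

text \<open>
  Paths are lists of arcs, so that parallel arcs give different paths. A route has at least one
  arc: the trivial path at an isolated vertex is not a route.
\<close>

definition route :: "('v, 'e) pre_digraph \<Rightarrow> 'e list \<Rightarrow> bool" where
  "route G R \<longleftrightarrow> R \<noteq> [] \<and> (\<exists>u w. source G u \<and> sink G w \<and> pre_digraph.apath G u R w)"

definition In_paths :: "('v, 'e) pre_digraph \<Rightarrow> 'v \<Rightarrow> 'e list set" where
  "In_paths G v = {P. \<exists>u. source G u \<and> pre_digraph.apath G u P v}"

definition Out_paths :: "('v, 'e) pre_digraph \<Rightarrow> 'v \<Rightarrow> 'e list set" where
  "Out_paths G v = {P. \<exists>w. sink G w \<and> pre_digraph.apath G v P w}"

record ('v, 'e) framing =
  in_order :: "'v \<Rightarrow> 'e rel"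
  out_order :: "'v \<Rightarrow> 'e rel"

text \<open>The linear orders are the strict ones; their values at vertices that are not inner are
  irrelevant.\<close>

definition is_framing :: "('v, 'e) pre_digraph \<Rightarrow> ('v, 'e) framing \<Rightarrow> bool" where
  "is_framing G F \<longleftrightarrow> (\<forall>v. inner G v \<longrightarrow>
     in_order F v \<subseteq> in_arcs G v \<times> in_arcs G v \<and>
     strict_linear_order_on (in_arcs G v) (in_order F v) \<and>
     out_order F v \<subseteq> out_arcs G v \<times> out_arcs G v \<and>
     strict_linear_order_on (out_arcs G v) (out_order F v))"

text \<open>
  In the next two definitions, \<open>S\<close> is the maximal common final (initial) segment. Its first vertex
  is the common head of \<open>a\<close> and \<open>b\<close>, respectively its last vertex is their common tail.
\<close>

definition In_less ::
    "('v, 'e) pre_digraph \<Rightarrow> ('v, 'e) framing \<Rightarrow> 'v \<Rightarrow> 'e list \<Rightarrow> 'e list \<Rightarrow> bool" where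
  "In_less G F v P Q \<longleftrightarrow> P \<in> In_paths G v \<and> Q \<in> In_paths G v \<and>
     (\<exists>P' Q' a b S. P = P' @ a # S \<and> Q = Q' @ b # S \<and> a \<noteq> b \<and> (a, b) \<in> in_order F (head G a))"

definition Out_less ::
    "('v, 'e) pre_digraph \<Rightarrow> ('v, 'e) framing \<Rightarrow> 'v \<Rightarrow> 'e list \<Rightarrow> 'e list \<Rightarrow> bool" where
  "Out_less G F v P Q \<longleftrightarrow> P \<in> Out_paths G v \<and> Q \<in> Out_paths G v \<and>
     (\<exists>S a b P' Q'. P = S @ a # P' \<and> Q = S @ b # Q' \<and> a \<noteq> b \<and> (a, b) \<in> out_order F (tail G a))"

definition route_verts :: "('v, 'e) pre_digraph \<Rightarrow> 'e list \<Rightarrow> 'v set" where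
  "route_verts G R = tail G ` set R \<union> head G ` set R"

text \<open>
  The parts of \<open>R\<close> before and after \<open>v\<close>. They are used only for an inner vertex \<open>v\<close> on a route
  \<open>R\<close>; then exactly one arc of \<open>R\<close> has tail \<open>v\<close>.
\<close>

definition route_to :: "('v, 'e) pre_digraph \<Rightarrow> 'e list \<Rightarrow> 'v \<Rightarrow> 'e list" where
  "route_to G R v = takeWhile (\<lambda>e. tail G e \<noteq> v) R"

definition route_from :: "('v, 'e) pre_digraph \<Rightarrow> 'v \<Rightarrow> 'e list \<Rightarrow> 'e list" where
  "route_from G v R = dropWhile (\<lambda>e. tail G e \<noteq> v) R"

definition conflict_at ::
    "('v, 'e) pre_digraph \<Rightarrow> ('v, 'e) framing \<Rightarrow> 'v \<Rightarrow> 'e list \<Rightarrow> 'e list \<Rightarrow> bool" where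
  "conflict_at G F v P Q \<longleftrightarrow>
     In_less G F v (route_to G P v) (route_to G Q v) \<and>
       Out_less G F v (route_from G v Q) (route_from G v P) \<or>
     In_less G F v (route_to G Q v) (route_to G P v) \<and>
       Out_less G F v (route_from G v P) (route_from G v Q)"

definition coherent ::
    "('v, 'e) pre_digraph \<Rightarrow> ('v, 'e) framing \<Rightarrow> 'e list \<Rightarrow> 'e list \<Rightarrow> bool" where
  "coherent G F P Q \<longleftrightarrow>
     (\<forall>v. inner G v \<and> v \<in> route_verts G P \<and> v \<in> route_verts G Q \<longrightarrow> \<not> conflict_at G F v P Q)"

definition exceptional :: "('v, 'e) pre_digraph \<Rightarrow> ('v, 'e) framing \<Rightarrow> 'e list \<Rightarrow> bool" where
  "exceptional G F R \<longleftrightarrow> route G R \<and> (\<forall>Q. route G Q \<longrightarrow> coherent G F R Q)"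

text \<open>The space of real functions on the arcs of \<open>G\<close> is the coordinate subspace of
  \<^typ>\<open>real ^ 'e\<close> of the vectors that vanish outside \<open>arcs G\<close>.\<close>

definition flow_cone :: "('v, 'e::finite) pre_digraph \<Rightarrow> (real ^ 'e) set" where
  "flow_cone G = {f. (\<forall>e. e \<notin> arcs G \<longrightarrow> f $ e = 0) \<and> (\<forall>e \<in> arcs G. 0 \<le> f $ e) \<and>
     (\<forall>v. inner G v \<longrightarrow> (\<Sum>e \<in> in_arcs G v. f $ e) = (\<Sum>e \<in> out_arcs G v. f $ e))}"

definition route_vector :: "'e list \<Rightarrow> real ^ 'e::finite" where
  "route_vector R = (\<chi> e. if e \<in> set R then 1 else 0)"

definition ample :: "('v, 'e::finite) pre_digraph \<Rightarrow> ('v, 'e) framing \<Rightarrow> bool" where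
  "ample G F \<longleftrightarrow> \<not> (\<exists>K. K facet_of flow_cone G \<and> route_vector ` {R. exceptional G F R} \<subseteq> K)"

text \<open>An undirected graph is a digraph with both arcs for each edge.\<close>

definition Adj ::
    "('v, 'e) pre_digraph \<Rightarrow> 'e list set \<Rightarrow> ('e list, 'e list \<times> 'e list) pre_digraph" where
  "Adj G X = \<lparr>verts = X,
     arcs = {(R, S). R \<in> X \<and> S \<in> X \<and> R \<noteq> S \<and>
       (\<exists>v. full_vertex G v \<and> v \<in> route_verts G R \<and> v \<in> route_verts G S)},
     tail = fst, head = snd\<rparr>"

definition bipartite :: "('a, 'b) pre_digraph \<Rightarrow> bool" where
  "bipartite H \<longleftrightarrow> (\<exists>A B. verts H = A \<union> B \<and> A \<inter> B = {} \<and>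
     (\<forall>e \<in> arcs H. tail H e \<in> A \<and> head H e \<in> B \<or> tail H e \<in> B \<and> head H e \<in> A))"

end

theory Submission
  imports Defs "HOL-Library.Sublist"
begin

text \<open>
  Every proper face of the flow cone lies in a facet, so ampleness means that each arc lies on an
  exceptional route. In a full graph an exceptional route uses either the smaller arc on both sides
  of every inner vertex it visits or the larger one, since otherwise swapping two of its arcs for
  their rivals yields a route in conflict with it. Hence an arc determines the exceptional route
  through it, and routes that meet have different colours (smaller or larger). Conversely, given a
  2-colouring of \<open>X\<close>, order the arcs at each inner vertex by the colours of their routes: a conflict
  involving a route of \<open>X\<close> would give that route both colours.
\<close>

section \<open>Walks and routes in an acyclic digraph\<close>

lemma (in wf_digraph) inner_iff:
  "inner G v \<longleftrightarrow> (\<exists>a \<in> arcs G. head G a = v) \<and> (\<exists>b \<in> arcs G. tail G b = v)"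
  unfolding inner_def source_def sink_def in_arcs_def out_arcs_def by auto

lemma (in wf_digraph) awalk_ends_in_arc:
  assumes "awalk u p v" "p \<noteq> []"
  shows "\<exists>e \<in> set p. e \<in> arcs G \<and> head G e = v"
  using assms by (cases p rule: rev_cases) (auto simp: awalk_simps)

context dag
begin

text \<open>A repeated vertex would cut a nonempty closed walk out of \<open>p\<close>, and every
  closed walk yields a cycle. From here on, routes can be treated as walks, which append and split
  freely.\<close>

lemma awalk_imp_apath:
  assumes "awalk u p v"
  shows "apath u p v"
proof -
  have "distinct (awalk_verts u p)"
  proof (rule ccontr)
    assume "\<not> distinct (awalk_verts u p)"
    from awalk_not_distinct_decomp[OF assms this] obtain r w where "awalk w r w" "r \<noteq> []"
      by blast
    then have "closed_w r" by (auto simp: closed_w_def)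
    with closed_w_imp_cycle acyclic show False by blast
  qed
  with assms show ?thesis by (simp add: apath_def)
qed

lemma apath_iff_awalk: "apath u p v \<longleftrightarrow> awalk u p v"
  using awalk_imp_apath awalkI_apath by blast

lemma route_iff: "route G R \<longleftrightarrow> R \<noteq> [] \<and> (\<exists>u w. source G u \<and> sink G w \<and> awalk u R w)"
  by (simp add: route_def apath_iff_awalk)

lemma acyclic_arcs_ends: "Transitive_Closure.acyclic (arcs_ends G)"
  unfolding Transitive_Closure.acyclic_def
proof (intro allI notI)
  fix v assume "(v, v) \<in> (arcs_ends G)\<^sup>+"
  then obtain p where "awalk v p v" "p \<noteq> []" using reachable1_awalk by blast
  then have "closed_w p" by (auto simp: closed_w_def)
  with closed_w_imp_cycle acyclic show False by blast
qed

lemma finite_arcs_ends: "finite (arcs_ends G)"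
  by (simp add: arcs_ends_def)

text \<open>In a finite acyclic digraph the converse of the arc relation is well-founded, so
  following out-arcs must stop, and it can only stop at a sink.\<close>

lemma ex_Out_path:
  assumes "v \<in> verts G"
  shows "\<exists>p w. sink G w \<and> awalk v p w"
proof -
  have "wf ((arcs_ends G)\<inverse>)"
    using finite_acyclic_wf_converse[OF finite_arcs_ends acyclic_arcs_ends] .
  then show ?thesis using assms
  proof (induction v rule: wf_induct_rule)
    case (less v)
    show ?case
    proof (cases "sink G v")
      case True
      then have "awalk v [] v" using less.prems by (simp add: awalk_simps)
      with True show ?thesis by blast
    next
      case False
      then obtain e where e: "e \<in> arcs G" "tail G e = v"
        using less.prems unfolding sink_def out_arcs_def by blast
      then have "(head G e, v) \<in> (arcs_ends G)\<inverse>"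
        using in_arcs_imp_in_arcs_ends by fastforce
      with less.IH e obtain p w where "sink G w" "awalk (head G e) p w" by force
      with e have "awalk v (e # p) w" by (simp add: awalk_simps)
      with \<open>sink G w\<close> show ?thesis by blast
    qed
  qed
qed

lemma ex_In_path:
  assumes "v \<in> verts G"
  shows "\<exists>p u. source G u \<and> awalk u p v"
proof -
  have "wf (arcs_ends G)"
    using finite_acyclic_wf[OF finite_arcs_ends acyclic_arcs_ends] .
  then show ?thesis using assms
  proof (induction v rule: wf_induct_rule)
    case (less v)
    show ?case
    proof (cases "source G v")
      case True
      then have "awalk v [] v" using less.prems by (simp add: awalk_simps)
      with True show ?thesis by blast
    next
      case False
      then obtain e where e: "e \<in> arcs G" "head G e = v"
        using less.prems unfolding source_def in_arcs_def by blast
      then have "(tail G e, v) \<in> arcs_ends G"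
        using in_arcs_imp_in_arcs_ends by fastforce
      with less.IH e obtain p u where "source G u" "awalk u p (tail G e)" by force
      moreover from e have "awalk (tail G e) [e] v"
        using arc_implies_awalk by blast
      ultimately show ?thesis using awalk_appendI by blast
    qed
  qed
qed

text \<open>Acyclicity rules out repeated vertices, so any prolongation to a source and to a sink
  works and nothing has to be checked where the three pieces meet.\<close>

lemma awalk_extend_to_route:
  assumes "awalk x p y" "p \<noteq> []"
  shows "\<exists>P T. route G (P @ p @ T) \<and> P \<in> In_paths G x \<and> T \<in> Out_paths G y"
proof -
  obtain P u where P: "source G u" "awalk u P x"
    using ex_In_path assms(1) awalk_hd_in_verts by blast
  obtain T w where T: "sink G w" "awalk y T w"
    using ex_Out_path assms(1) awalk_last_in_verts by blast
  have "awalk u (P @ p @ T) w" using P T assms(1) awalk_appendI by blast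
  then have "route G (P @ p @ T)" using P T assms(2) unfolding route_iff by blast
  moreover have "P \<in> In_paths G x" "T \<in> Out_paths G y"
    using P T by (auto simp: In_paths_def Out_paths_def apath_iff_awalk)
  ultimately show ?thesis by blast
qed

lemma ex_route_through_arc:
  assumes "e \<in> arcs G"
  shows "\<exists>R. route G R \<and> e \<in> set R"
  using awalk_extend_to_route[OF arc_implies_awalk[OF assms]] by fastforce

section \<open>Arcs of a route and its cut at a vertex\<close>

lemma route_arcs: "route G R \<Longrightarrow> set R \<subseteq> arcs G"
  by (auto simp: route_iff)

lemma route_distinct_tails:
  assumes "route G R"
  shows "distinct (map (tail G) R)"
  using assms unfolding route_def apath_def by (auto simp: awalk_verts_conv)

lemma route_distinct_heads:
  assumes "route G R"
  shows "distinct (map (head G) R)"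
proof -
  from assms obtain u w where "cas u R w" "distinct (awalk_verts u R)" "R \<noteq> []"
    unfolding route_def apath_def by auto
  \<comment> \<open>Here the vertex list is read as the first tail followed by all heads, not as all
    tails followed by the last head.\<close>
  then show ?thesis by (simp add: awalk_verts_conv')
qed

lemma route_eq_arc_if_same_head:
  assumes "route G R" "a \<in> set R" "b \<in> set R" "head G a = head G b"
  shows "a = b"
  using route_distinct_heads[OF assms(1)] assms(2-) by (auto simp: distinct_map inj_on_def)

lemma route_eq_arc_if_same_tail:
  assumes "route G R" "a \<in> set R" "b \<in> set R" "tail G a = tail G b"
  shows "a = b"
  using route_distinct_tails[OF assms(1)] assms(2-) by (auto simp: distinct_map inj_on_def)

lemma finite_routes: "finite {R. route G R}"
  by (rule finite_subset[OF _ finite_imageI[OF apaths_finite_triple, of "fst \<circ> snd"]])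
    (force simp: route_def)

lemma route_split:
  assumes "route G R" "R = P @ a # T"
  shows "\<exists>u. source G u \<and> awalk u P (tail G a)" "\<exists>w. sink G w \<and> awalk (head G a) T w"
proof -
  from assms obtain u w where uw: "source G u" "sink G w" "awalk u (P @ a # T) w"
    by (auto simp: route_iff)
  from uw(3) have "awalk u P (awlast u P)" "awalk (awlast u P) (a # T) w"
    by (simp_all only: awalk_append_iff)
  with uw show "\<exists>u. source G u \<and> awalk u P (tail G a)" "\<exists>w. sink G w \<and> awalk (head G a) T w"
    by (auto simp: awalk_simps)
qed

text \<open>Tails along a route are distinct, so the search for the first arc with tail
  \<open>tail G b\<close> stops exactly at \<open>b\<close>.\<close>

lemma route_to_from_append:
  assumes "route G (P @ b # Q)"
  shows "route_to G (P @ b # Q) (tail G b) = P" "route_from G (tail G b) (P @ b # Q) = b # Q"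
proof -
  have "tail G e \<noteq> tail G b" if "e \<in> set P" for e
    using route_eq_arc_if_same_tail[OF assms, of e b] route_distinct_tails[OF assms] that
    by (auto simp: distinct_map)
  then show "route_to G (P @ b # Q) (tail G b) = P"
      "route_from G (tail G b) (P @ b # Q) = b # Q"
    by (simp_all add: route_to_def route_from_def)
qed

text \<open>A route starts at a source, so an arc leaving an inner vertex cannot be its first arc,
  and the arc before it enters that vertex.\<close>

lemma route_enters_inner:
  assumes "route G R" "inner G v" "v \<in> route_verts G R"
  shows "\<exists>a \<in> set R. head G a = v"
proof (rule ccontr)
  assume no: "\<not> ?thesis"
  with assms(3) obtain b where b: "b \<in> set R" "tail G b = v" by (auto simp: route_verts_def)
  then obtain P T where R: "R = P @ b # T" by (meson split_list)
  from route_split(1)[OF assms(1) R] b obtain u where u: "source G u" "awalk u P v" by blast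
  show False
  proof (cases P rule: rev_cases)
    case Nil
    with u assms(2) show False by (simp add: awalk_simps inner_def)
  next
    case (snoc P' a)
    with u have "head G a = v" by (auto simp: awalk_simps)
    with no R snoc show False by auto
  qed
qed

section \<open>Divergence of paths and comparisons along exceptional routes\<close>

text \<open>No arc leaves a sink, so neither path is a prefix of the other. Lists that are
  incomparable for the prefix order have a first position at which they differ.\<close>

lemma diverging_awalks_to_sinks:
  assumes "awalk v p x" "sink G x" "awalk v q y" "sink G y" "p \<noteq> q"
  shows "\<exists>M c p' c' q'. c \<noteq> c' \<and> p = M @ c # p' \<and> q = M @ c' # q'"
proof -
  have stuck: "r = []" if "awalk v s x" "sink G x" "awalk v (s @ r) y" for s r x y
  proof (rule ccontr)
    assume "r \<noteq> []"
    then obtain c r' where "r = c # r'" by (cases r) auto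
    with that(1,3) have "c \<in> arcs G" "tail G c = x" by (auto simp: awalk_simps)
    with that(2) show False by (auto simp: sink_def)
  qed
  have "\<not> prefix p q" "\<not> prefix q p"
    using assms stuck[OF assms(1,2)] stuck[OF assms(3,4)]
    by (auto simp del: awalk_append_iff elim!: prefixE)
  then show ?thesis using parallel_decomp[of p q] by blast
qed

lemma diverging_awalks_from_sources:
  assumes "awalk x p v" "source G x" "awalk y q v" "source G y" "p \<noteq> q"
  shows "\<exists>M c p' c' q'. c \<noteq> c' \<and> p = p' @ c # M \<and> q = q' @ c' # M"
proof -
  have stuck: "r = []" if "awalk x s v" "source G x" "awalk y (r @ s) v" for s r x y
  proof (rule ccontr)
    assume "r \<noteq> []"
    then obtain c r' where r: "r = r' @ [c]" by (cases r rule: rev_cases) auto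
    with that(3) have c: "c \<in> arcs G" "awalk (head G c) s v" by (auto simp: awalk_simps)
    \<comment> \<open>A nonempty \<open>s\<close> determines its start; an empty one starts at its
      end \<open>v\<close> in both walks.\<close>
    with that(1) awalk_ends[OF c(2) that(1)] have "head G c = x" by auto
    with that(2) c show False by (auto simp: source_def)
  qed
  \<comment> \<open>Reversal turns common final segments into common prefixes.\<close>
  have "\<not> prefix (rev p) (rev q)" "\<not> prefix (rev q) (rev p)"
    using assms stuck[OF assms(1,2)] stuck[OF assms(3,4)]
    by (auto simp: suffix_to_prefix[symmetric] simp del: awalk_append_iff elim!: suffixE)
  then obtain M c p' c' q' where
    *: "c \<noteq> c'" "rev p = M @ c # p'" "rev q = M @ c' # q'"
    using parallel_decomp[of "rev p" "rev q"] by blast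
  then have "p = rev p' @ c # rev M" "q = rev q' @ c' # rev M"
    by (metis append.assoc append_Cons append_Nil rev.simps(2) rev_append rev_rev_ident)+
  with *(1) show ?thesis by blast
qed

text \<open>If the two orders disagreed, the route that replaces \<open>a\<close> by \<open>a'\<close> and \<open>c\<close> by \<open>c'\<close> would be
  in conflict with \<open>R\<close> at the head of \<open>a\<close>.\<close>

lemma exceptional_in_order_iff_out_order:
  assumes F: "is_framing G F" and exc: "exceptional G F R" and R: "R = P @ a # M @ c # T"
    and a': "a' \<in> in_arcs G (head G a)" "a \<noteq> a'" and c': "c' \<in> out_arcs G (tail G c)" "c \<noteq> c'"
  shows "(a, a') \<in> in_order F (head G a) \<longleftrightarrow> (c, c') \<in> out_order F (tail G c)"
proof -
  let ?v = "head G a"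
  have route: "route G R" using exc by (simp add: exceptional_def)
  from route_split(1)[OF route R] obtain u where u: "source G u" "awalk u P (tail G a)" by blast
  from route_split(2)[OF route R] obtain w where w: "sink G w" "awalk ?v (M @ c # T) w" by blast
  from route_arcs[OF route] R have arcs: "a \<in> arcs G" "c \<in> arcs G" by auto
  from w have M: "awalk ?v M (tail G c)" by (auto simp: awalk_simps)
  have Mc': "awalk ?v (M @ [c']) (head G c')"
  proof (rule awalk_appendI[OF M])
    show "awalk (tail G c) [c'] (head G c')" using c' by (simp add: awalk_simps)
  qed
  then have "awalk (tail G a') (a' # M @ [c']) (head G c')"
    using a' by (simp add: awalk_Cons_iff del: awalk_append_iff)
  from awalk_extend_to_route[OF this] obtain P' T' where
    route': "route G (P' @ (a' # M @ [c']) @ T')" and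
    P': "P' \<in> In_paths G (tail G a')" and T': "T' \<in> Out_paths G (head G c')" by blast
  define Q where "Q = P' @ a' # M @ c' # T'"
  have Q: "route G Q" using route' by (simp add: Q_def)
  \<comment> \<open>A route is cut at \<open>?v\<close> just before the arc that leaves
    \<open>?v\<close>. This is the first arc of \<open>M\<close>, or \<open>c\<close> (respectively
    \<open>c'\<close>) when \<open>M\<close> is empty; \<open>b\<close> and \<open>b'\<close> name
    it in either case.\<close>
  obtain b L where bL: "M @ c # T = b # L" by (cases "M @ c # T") auto
  obtain b' L' where bL': "M @ c' # T' = b' # L'" by (cases "M @ c' # T'") auto
  have "tail G b = ?v" using w(2) bL by (simp add: awalk_simps)
  have "awalk ?v (M @ [c'] @ T') y" if "awalk (head G c') T' y" for y
    using awalk_appendI[OF Mc' that] by simp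
  moreover obtain y where y: "sink G y" "awalk (head G c') T' y"
    using T' by (auto simp: Out_paths_def apath_iff_awalk)
  ultimately have wQ: "awalk ?v (M @ c' # T') y" by simp
  then have "tail G b' = ?v" using bL' by (simp add: awalk_simps)
  have segs: "route_to G R ?v = P @ [a]" "route_from G ?v R = M @ c # T"
    using route_to_from_append[of "P @ [a]" b L] route R bL \<open>tail G b = ?v\<close> by auto
  have segs': "route_to G Q ?v = P' @ [a']" "route_from G ?v Q = M @ c' # T'"
    using route_to_from_append[of "P' @ [a']" b' L'] Q bL' \<open>tail G b' = ?v\<close> by (auto simp: Q_def)
  obtain x where x: "source G x" "awalk x P' (tail G a')"
    using P' by (auto simp: In_paths_def apath_iff_awalk)
  have ins: "P @ [a] \<in> In_paths G ?v" "P' @ [a'] \<in> In_paths G ?v"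
    using awalk_appendI[OF u(2) arc_implies_awalk] awalk_appendI[OF x(2) arc_implies_awalk]
      u x arcs a' by (auto simp: In_paths_def apath_iff_awalk simp del: awalk_append_iff)
  have In: "In_less G F ?v (P @ [a]) (P' @ [a'])" if "(a, a') \<in> in_order F ?v"
    using that a' ins unfolding In_less_def by blast
  have In': "In_less G F ?v (P' @ [a']) (P @ [a])" if "(a', a) \<in> in_order F ?v"
    using that a' ins unfolding In_less_def by fastforce
  have outs: "M @ c # T \<in> Out_paths G ?v" "M @ c' # T' \<in> Out_paths G ?v"
    using w wQ y by (auto simp: Out_paths_def apath_iff_awalk simp del: awalk_append_iff)
  have Out: "Out_less G F ?v (M @ c # T) (M @ c' # T')" if "(c, c') \<in> out_order F (tail G c)"
    using that c' outs unfolding Out_less_def by blast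
  have Out': "Out_less G F ?v (M @ c' # T') (M @ c # T)" if "(c', c) \<in> out_order F (tail G c)"
    using that c' outs unfolding Out_less_def by fastforce
  \<comment> \<open>Both vertices are inner: \<open>a\<close> enters \<open>?v\<close> and
    \<open>b\<close> leaves it, while the last arc of \<open>a # M\<close> enters
    \<open>tail G c\<close> and \<open>c\<close> leaves it. They coincide when \<open>M\<close> is
    empty.\<close>
  have "b \<in> arcs G" using w(2) bL by (simp add: awalk_simps)
  moreover have "awalk (tail G a) (a # M) (tail G c)" using M arcs by (simp add: awalk_simps)
  then have "\<exists>d \<in> arcs G. head G d = tail G c" using awalk_ends_in_arc[of _ "a # M"] by blast
  ultimately have inner: "inner G ?v" "inner G (tail G c)"
    using arcs \<open>tail G b = ?v\<close> unfolding inner_iff by blast+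
  have "?v \<in> route_verts G R" "?v \<in> route_verts G Q"
    using a' by (auto simp: route_verts_def R Q_def)
  then have "\<not> conflict_at G F ?v R Q"
    using exc Q inner by (auto simp: exceptional_def coherent_def)
  \<comment> \<open>Each line excludes one pair of opposite comparisons. Totality at the two
    vertices then turns the exclusions into the equivalence.\<close>
  then have no: "\<not> ((a, a') \<in> in_order F ?v \<and> (c', c) \<in> out_order F (tail G c))"
      "\<not> ((a', a) \<in> in_order F ?v \<and> (c, c') \<in> out_order F (tail G c))"
    using In In' Out Out' unfolding conflict_at_def segs segs' by blast+
  have "total_on (in_arcs G ?v) (in_order F ?v)"
      "total_on (out_arcs G (tail G c)) (out_order F (tail G c))"
    using F inner by (auto simp: is_framing_def strict_linear_order_on_def)
  then have "(a, a') \<in> in_order F ?v \<or> (a', a) \<in> in_order F ?v"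
      "(c, c') \<in> out_order F (tail G c) \<or> (c', c) \<in> out_order F (tail G c)"
    using a' c' arcs unfolding total_on_def by auto
  with no show ?thesis by blast
qed

section \<open>Uniqueness and consistency of exceptional routes\<close>

lemma framing_asym:
  assumes "is_framing G F" "inner G v"
  shows "(a, b) \<in> in_order F v \<Longrightarrow> (b, a) \<notin> in_order F v"
    "(a, b) \<in> out_order F v \<Longrightarrow> (b, a) \<notin> out_order F v"
  using assms unfolding is_framing_def strict_linear_order_on_def
  by (meson irreflD transD)+

lemma framing_total:
  assumes "is_framing G F" "inner G v" "a \<noteq> b"
  shows "a \<in> in_arcs G v \<Longrightarrow> b \<in> in_arcs G v \<Longrightarrow>
      (a, b) \<in> in_order F v \<or> (b, a) \<in> in_order F v"
    "a \<in> out_arcs G v \<Longrightarrow> b \<in> out_arcs G v \<Longrightarrow>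
      (a, b) \<in> out_order F v \<or> (b, a) \<in> out_order F v"
  using assms unfolding is_framing_def strict_linear_order_on_def total_on_def
  by meson+

text \<open>Supplies the rival arcs that \<open>exceptional_in_order_iff_out_order\<close> requires
  on both sides.\<close>

lemma full_ex_other_arc:
  assumes "full G" "inner G v"
  shows "\<exists>b \<in> in_arcs G v. a \<noteq> b" "\<exists>b \<in> out_arcs G v. a \<noteq> b"
proof -
  have "card (in_arcs G v) = 2" "card (out_arcs G v) = 2"
    using assms by (auto simp: full_def full_vertex_def in_degree_def out_degree_def)
  then show "\<exists>b \<in> in_arcs G v. a \<noteq> b" "\<exists>b \<in> out_arcs G v. a \<noteq> b"
    unfolding card_2_iff by auto
qed

text \<open>Suppose that \<open>R\<close> and \<open>S\<close> separate after \<open>e\<close> along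
  \<open>c\<close> and \<open>c'\<close>. The comparison of \<open>e\<close> with a rival in-arc at
  its head decides whether \<open>c\<close> precedes \<open>c'\<close>, because \<open>R\<close> is
  exceptional, and equally whether \<open>c'\<close> precedes \<open>c\<close>, because
  \<open>S\<close> is; no strict linear order allows this. Before \<open>e\<close> the argument is
  mirrored, with a rival out-arc at the tail of \<open>e\<close>.\<close>

lemma exceptional_unique_through_arc:
  assumes F: "is_framing G F" and "full G" and R: "exceptional G F R" and S: "exceptional G F S"
    and e: "e \<in> set R" "e \<in> set S"
  shows "R = S"
proof -
  have routes: "route G R" "route G S" using R S by (auto simp: exceptional_def)
  from e obtain P T P' T' where Re: "R = P @ e # T" and Se: "S = P' @ e # T'"
    by (meson split_list)
  have "e \<in> arcs G" using route_arcs[OF routes(1)] e by auto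
  have "T = T'"
  proof (rule ccontr)
    assume "T \<noteq> T'"
    with diverging_awalks_to_sinks route_split(2)[OF routes(1) Re] route_split(2)[OF routes(2) Se]
    obtain M c U c' U' where *: "c \<noteq> c'" "T = M @ c # U" "T' = M @ c' # U'" by metis
    have cs: "c \<in> arcs G" "c' \<in> arcs G"
      using route_arcs[OF routes(1)] route_arcs[OF routes(2)] Re Se * by auto
    have M: "awalk (head G e) M (tail G c)" "awalk (head G e) M (tail G c')"
      using route_split(2)[OF routes(1) Re] route_split(2)[OF routes(2) Se] *
      by (auto simp: awalk_simps)
    have tails: "tail G c = tail G c'"
      using awalk_ends[OF M] by auto
    have "awalk (tail G e) (e # M) (tail G c)" using M \<open>e \<in> arcs G\<close> by (simp add: awalk_simps)
    then have inner_c: "inner G (tail G c)"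
      using awalk_ends_in_arc[of _ "e # M"] cs unfolding inner_iff by blast
    \<comment> \<open>The arc leaving the head of \<open>e\<close> is the first arc of
      \<open>M\<close>, or \<open>c\<close> itself if \<open>M\<close> is empty.\<close>
    have "\<exists>b \<in> arcs G. tail G b = head G e"
      using M(1) cs by (cases M) (auto simp: awalk_simps)
    then have "inner G (head G e)" using \<open>e \<in> arcs G\<close> unfolding inner_iff by blast
    from full_ex_other_arc(1)[OF \<open>full G\<close> this] obtain a where
      a: "a \<in> in_arcs G (head G e)" "e \<noteq> a" by blast
    have "(e, a) \<in> in_order F (head G e) \<longleftrightarrow> (c, c') \<in> out_order F (tail G c)"
      using exceptional_in_order_iff_out_order[OF F R, of P e M c U a c'] Re * a cs tails by simp
    moreover have "(e, a) \<in> in_order F (head G e) \<longleftrightarrow> (c', c) \<in> out_order F (tail G c)"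
      using exceptional_in_order_iff_out_order[OF F S, of P' e M c' U' a c] Se * a cs tails by simp
    ultimately show False
      using framing_total(2)[OF F inner_c *(1)] framing_asym(2)[OF F inner_c] cs tails by auto
  qed
  moreover have "P = P'"
  proof (rule ccontr)
    assume "P \<noteq> P'"
    with diverging_awalks_from_sources
      route_split(1)[OF routes(1) Re] route_split(1)[OF routes(2) Se]
    obtain M a U a' U' where *: "a \<noteq> a'" "P = U @ a # M" "P' = U' @ a' # M" by metis
    have as: "a \<in> arcs G" "a' \<in> arcs G"
      using route_arcs[OF routes(1)] route_arcs[OF routes(2)] Re Se * by auto
    have M: "awalk (head G a) M (tail G e)" "awalk (head G a') M (tail G e)"
      using route_split(1)[OF routes(1) Re] route_split(1)[OF routes(2) Se] *
      by (auto simp: awalk_simps)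
    have heads: "head G a = head G a'"
      using awalk_ends[OF M] by auto
    have "\<exists>b \<in> arcs G. tail G b = head G a"
      using M(1) \<open>e \<in> arcs G\<close> by (cases M) (auto simp: awalk_simps)
    then have inner_a: "inner G (head G a)" using as unfolding inner_iff by blast
    have "awalk (tail G a) (a # M) (tail G e)" using M as by (simp add: awalk_simps)
    then have "inner G (tail G e)"
      using awalk_ends_in_arc[of _ "a # M"] \<open>e \<in> arcs G\<close> unfolding inner_iff by blast
    from full_ex_other_arc(2)[OF \<open>full G\<close> this] obtain c where
      c: "c \<in> out_arcs G (tail G e)" "e \<noteq> c" by blast
    have "(a, a') \<in> in_order F (head G a) \<longleftrightarrow> (e, c) \<in> out_order F (tail G e)"
      using exceptional_in_order_iff_out_order[OF F R, of U a M e T a' c] Re * c as heads by simp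
    moreover have "(a', a) \<in> in_order F (head G a) \<longleftrightarrow> (e, c) \<in> out_order F (tail G e)"
      using exceptional_in_order_iff_out_order[OF F S, of U' a' M e T' a c] Se * c as heads by simp
    ultimately show False
      using framing_total(1)[OF F inner_a *(1)] framing_asym(1)[OF F inner_a] as heads by auto
  qed
  ultimately show ?thesis by (simp add: Re Se)
qed

text \<open>Both in-arcs are compared with the last arc of the route, an out-arc of an inner vertex.\<close>

lemma exceptional_in_order_consistent:
  assumes F: "is_framing G F" and "full G" and S: "exceptional G F S"
    and b: "b \<in> set S" "inner G (head G b)" "b' \<in> in_arcs G (head G b)" "b \<noteq> b'"
    and c: "c \<in> set S" "inner G (head G c)" "c' \<in> in_arcs G (head G c)" "c \<noteq> c'"
  shows "(b, b') \<in> in_order F (head G b) \<longleftrightarrow> (c, c') \<in> in_order F (head G c)"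
proof -
  have route: "route G S" using S by (simp add: exceptional_def)
  \<comment> \<open>A route ends at a sink, so it continues beyond an inner head, and its last arc
    comes strictly after \<open>a\<close>.\<close>
  have last: "\<exists>P M. S = P @ a # M @ [last S]" if a: "a \<in> set S" "inner G (head G a)" for a
  proof -
    obtain P T where *: "S = P @ a # T" using split_list[OF a(1)] by blast
    have "T \<noteq> []"
      using route_split(2)[OF route *] a(2) by (auto simp: awalk_simps inner_def)
    then have "S = P @ a # butlast T @ [last S]" using * by simp
    then show ?thesis by blast
  qed
  let ?d = "last S"
  from last[OF b(1,2)] obtain P M where b_last: "S = P @ b # M @ [?d]" by blast
  from last[OF c(1,2)] obtain P' M' where c_last: "S = P' @ c # M' @ [?d]" by blast
  have d: "?d \<in> arcs G" using route_arcs[OF route] b_last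
    by (metis in_set_conv_decomp append_assoc append_Cons subsetD)
  have "awalk (head G b) M (tail G ?d)"
    using route_split(2)[OF route b_last] by (auto simp: awalk_simps)
  moreover have "b \<in> arcs G" using route_arcs[OF route] b(1) by auto
  ultimately have "awalk (tail G b) (b # M) (tail G ?d)" by (simp add: awalk_simps)
  then have "inner G (tail G ?d)"
    using awalk_ends_in_arc[of _ "b # M"] d unfolding inner_iff by blast
  from full_ex_other_arc(2)[OF \<open>full G\<close> this] obtain d' where
    d': "d' \<in> out_arcs G (tail G ?d)" "?d \<noteq> d'" by blast
  show ?thesis
    using exceptional_in_order_iff_out_order[OF F S b_last b(3,4) d']
      exceptional_in_order_iff_out_order[OF F S c_last c(3,4) d'] by simp
qed

section \<open>Two-colouring of the exceptional routes\<close>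

text \<open>Two distinct exceptional routes that meet at an inner vertex enter it by different arcs.
  One of these arcs is the smaller, and by consistency along each route it settles the colours of
  both routes.\<close>

lemma bipartite_Adj_exceptional:
  assumes F: "is_framing G F" and "full G"
  shows "bipartite (Adj G {R. exceptional G F R})"
proof -
  \<comment> \<open>One smaller in-arc is enough to define the colour, since all in-arcs of an
    exceptional route at inner vertices compare alike with their rivals. A route without inner
    vertices is not \<open>lower\<close>; it has no neighbours in the adjacency graph.\<close>
  define lower where "lower R \<longleftrightarrow>
    (\<exists>a \<in> set R. inner G (head G a) \<and> (\<exists>b. (a, b) \<in> in_order F (head G a)))" for R
  have key: "lower R \<noteq> lower S" if R: "exceptional G F R" and S: "exceptional G F S" and "R \<noteq> S"
    and v: "inner G v" "v \<in> route_verts G R" "v \<in> route_verts G S" for R S v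
  proof -
    \<comment> \<open>If \<open>S\<close> took a smaller in-arc anywhere, then \<open>b\<close>
      would have to be the smaller arc at \<open>v\<close> too.\<close>
    have *: "\<not> lower S" if S: "exceptional G F S" and b: "b \<in> set S" "head G b = v"
      and a: "a \<in> arcs G" "head G a = v" "(a, b) \<in> in_order F v" for S a b
    proof
      assume "lower S"
      then obtain c c' where c: "c \<in> set S" "inner G (head G c)" "(c, c') \<in> in_order F (head G c)"
        by (auto simp: lower_def)
      have ne: "a \<noteq> b" "c \<noteq> c'"
        using framing_asym(1)[OF F] a(3) v(1) c by blast+
      have "c' \<in> in_arcs G (head G c)"
        using F c unfolding is_framing_def by blast
      then have "(b, a) \<in> in_order F v"
        using exceptional_in_order_consistent[OF F \<open>full G\<close> S, of b a c c'] a b c ne v(1) by auto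
      with framing_asym(1)[OF F v(1)] a(3) show False by blast
    qed
    have routes: "route G R" "route G S" using R S by (auto simp: exceptional_def)
    obtain a b where a: "a \<in> set R" "head G a = v" and b: "b \<in> set S" "head G b = v"
      using route_enters_inner routes v by metis
    have arcs: "a \<in> arcs G" "b \<in> arcs G"
      using route_arcs[OF routes(1)] route_arcs[OF routes(2)] a b by auto
    have "a \<noteq> b"
      using exceptional_unique_through_arc[OF F \<open>full G\<close> R S] a b \<open>R \<noteq> S\<close> by blast
    then consider "(a, b) \<in> in_order F v" | "(b, a) \<in> in_order F v"
      using framing_total(1)[OF F v(1)] arcs a b by auto
    then show ?thesis
    proof cases
      case 1
      then have "lower R" using a v(1) by (auto simp: lower_def)
      moreover have "\<not> lower S" using *[OF S b arcs(1) a(2) 1] .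
      ultimately show ?thesis by blast
    next
      case 2
      then have "lower S" using b v(1) by (auto simp: lower_def)
      moreover have "\<not> lower R" using *[OF R a arcs(2) b(2) 2] .
      ultimately show ?thesis by blast
    qed
  qed
  show ?thesis
    unfolding bipartite_def
  proof (intro exI conjI ballI)
    let ?A = "{R. exceptional G F R \<and> lower R}" and ?B = "{R. exceptional G F R \<and> \<not> lower R}"
    let ?H = "Adj G {R. exceptional G F R}"
    show "verts ?H = ?A \<union> ?B" "?A \<inter> ?B = {}" by (auto simp: Adj_def)
    fix e assume "e \<in> arcs ?H"
    then obtain R S v where "e = (R, S)" "exceptional G F R" "exceptional G F S" "R \<noteq> S"
        "inner G v" "v \<in> route_verts G R" "v \<in> route_verts G S"
      by (auto simp: Adj_def full_vertex_def)
    with key[of R S v] show "tail ?H e \<in> ?A \<and> head ?H e \<in> ?B \<or> tail ?H e \<in> ?B \<and> head ?H e \<in> ?A"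
      by (auto simp: Adj_def)
  qed
qed

section \<open>A framing from a two-colouring\<close>

lemma ex_framing_if_bipartite:
  assumes "full G" and X: "X \<subseteq> {R. route G R}"
    and uniq: "\<forall>e \<in> arcs G. \<exists>!R. R \<in> X \<and> e \<in> set R" and bip: "bipartite (Adj G X)"
  shows "\<exists>F. is_framing G F \<and> {R. exceptional G F R} = X"
proof -
  obtain A B where AB: "X = A \<union> B" "A \<inter> B = {}"
    and adj: "\<And>R S v. R \<in> X \<Longrightarrow> S \<in> X \<Longrightarrow> R \<noteq> S \<Longrightarrow> inner G v \<Longrightarrow>
      v \<in> route_verts G R \<Longrightarrow> v \<in> route_verts G S \<Longrightarrow> R \<in> A \<and> S \<in> B \<or> R \<in> B \<and> S \<in> A"
  proof -
    from bip obtain A B where AB: "verts (Adj G X) = A \<union> B" "A \<inter> B = {}"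
      and arc: "\<forall>e \<in> arcs (Adj G X). tail (Adj G X) e \<in> A \<and> head (Adj G X) e \<in> B \<or>
        tail (Adj G X) e \<in> B \<and> head (Adj G X) e \<in> A"
      unfolding bipartite_def by blast
    show thesis
    proof (rule that[of A B])
      show "X = A \<union> B" "A \<inter> B = {}" using AB by (auto simp: Adj_def)
      fix R S v assume "R \<in> X" "S \<in> X" "R \<noteq> S" "inner G v"
        "v \<in> route_verts G R" "v \<in> route_verts G S"
      \<comment> \<open>Adjacency asks for a shared full vertex; in a full graph the inner vertex
        \<open>v\<close> is one.\<close>
      then have "(R, S) \<in> arcs (Adj G X)"
        using \<open>full G\<close> unfolding full_def Adj_def by auto
      with arc have "tail (Adj G X) (R, S) \<in> A \<and> head (Adj G X) (R, S) \<in> B \<or>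
          tail (Adj G X) (R, S) \<in> B \<and> head (Adj G X) (R, S) \<in> A" by blast
      then show "R \<in> A \<and> S \<in> B \<or> R \<in> B \<and> S \<in> A" by (simp add: Adj_def)
    qed
  qed
  \<comment> \<open>One global relation compares arcs by the colours of their routes; its
    restrictions to the arcs at a single vertex become the linear orders.\<close>
  define lt where "lt = {(a, b). (\<exists>R \<in> A. a \<in> set R) \<and> (\<exists>R \<in> B. b \<in> set R)}"
  define F where "F = \<lparr>in_order = \<lambda>v. lt \<inter> in_arcs G v \<times> in_arcs G v,
    out_order = \<lambda>v. lt \<inter> out_arcs G v \<times> out_arcs G v\<rparr>"
  have arcs: "e \<in> arcs G" if "R \<in> X" "e \<in> set R" for R e
    using that X route_arcs by blast
  have colour: "R \<in> A" if "R \<in> X" "a \<in> set R" "(a, b) \<in> lt" for R a b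
    using that uniq arcs AB unfolding lt_def by blast
  have colour': "R \<in> B" if "R \<in> X" "b \<in> set R" "(a, b) \<in> lt" for R a b
    using that uniq arcs AB unfolding lt_def by blast
  \<comment> \<open>Chains of two steps do not exist, so transitivity holds vacuously; the case of
    three equal arcs gives irreflexivity.\<close>
  have not_both: "(b, c) \<notin> lt" if "(a, b) \<in> lt" for a b c
  proof
    assume "(b, c) \<in> lt"
    moreover from that obtain R where "R \<in> B" "b \<in> set R" by (auto simp: lt_def)
    ultimately show False using colour AB by blast
  qed
  have total: "(a, b) \<in> lt \<or> (b, a) \<in> lt"
    if "inner G v" "a \<in> arcs G" "b \<in> arcs G" "a \<noteq> b"
      and same: "head G a = v \<and> head G b = v \<or> tail G a = v \<and> tail G b = v" for a b v
  proof -
    from that(2,3) uniq obtain R S where R: "R \<in> X" "a \<in> set R" and S: "S \<in> X" "b \<in> set S"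
      by blast
    \<comment> \<open>A route has at most one in-arc and at most one out-arc at a vertex, so
      \<open>a\<close> and \<open>b\<close> lie on different routes, and these have opposite colours
      because they share \<open>v\<close>.\<close>
    have "R \<noteq> S"
      using route_eq_arc_if_same_head route_eq_arc_if_same_tail R S X same \<open>a \<noteq> b\<close> by blast
    moreover have "v \<in> route_verts G R" "v \<in> route_verts G S"
      using R(2) S(2) same unfolding route_verts_def by (metis UnI1 UnI2 imageI)+
    ultimately show ?thesis
      using adj[OF R(1) S(1) _ \<open>inner G v\<close>] R S unfolding lt_def by blast
  qed
  have framing: "is_framing G F"
    unfolding is_framing_def
  proof (intro allI impI)
    fix v assume v: "inner G v"
    have "trans (in_order F v)" "trans (out_order F v)"
      by (auto simp: F_def intro!: transI dest: not_both)
    moreover have "irrefl (in_order F v)" "irrefl (out_order F v)"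
      by (auto simp: F_def intro!: irreflI dest: not_both)
    moreover have "total_on (in_arcs G v) (in_order F v)" "total_on (out_arcs G v) (out_order F v)"
      using total[OF v] by (auto simp: F_def total_on_def)
    ultimately show "in_order F v \<subseteq> in_arcs G v \<times> in_arcs G v \<and>
        strict_linear_order_on (in_arcs G v) (in_order F v) \<and>
        out_order F v \<subseteq> out_arcs G v \<times> out_arcs G v \<and>
        strict_linear_order_on (out_arcs G v) (out_order F v)"
      by (auto simp: strict_linear_order_on_def F_def)
  qed
  have exc: "exceptional G F R" if R: "R \<in> X" for R
  proof -
    have sub: "set (route_to G R v) \<subseteq> set R" "set (route_from G v R) \<subseteq> set R" for v
      by (auto simp: route_to_def route_from_def dest: set_takeWhileD set_dropWhileD)
    \<comment> \<open>The arc that decides a comparison involving a part of \<open>R\<close> lies on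
      \<open>R\<close>, so its side in \<open>lt\<close> reveals the colour of \<open>R\<close>. The
      next three facts are the other cases.\<close>
    have In: "R \<in> A" if "In_less G F v (route_to G R v) L" for v L
    proof -
      from that obtain P' a b S where "route_to G R v = P' @ a # S" "(a, b) \<in> lt"
        unfolding In_less_def F_def by auto
      then show ?thesis using colour[OF R, of a b] sub(1)[of v] by auto
    qed
    have In': "R \<in> B" if "In_less G F v L (route_to G R v)" for v L
    proof -
      from that obtain P' a b S where "route_to G R v = P' @ b # S" "(a, b) \<in> lt"
        unfolding In_less_def F_def by auto
      then show ?thesis using colour'[OF R, of b a] sub(1)[of v] by auto
    qed
    have Out: "R \<in> A" if "Out_less G F v (route_from G v R) L" for v L
    proof -
      from that obtain P' a b S where "route_from G v R = P' @ a # S" "(a, b) \<in> lt"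
        unfolding Out_less_def F_def by auto
      then show ?thesis using colour[OF R, of a b] sub(2)[of v] by auto
    qed
    have Out': "R \<in> B" if "Out_less G F v L (route_from G v R)" for v L
    proof -
      from that obtain P' a b S where "route_from G v R = P' @ b # S" "(a, b) \<in> lt"
        unfolding Out_less_def F_def by auto
      then show ?thesis using colour'[OF R, of b a] sub(2)[of v] by auto
    qed
    \<comment> \<open>In a conflict \<open>R\<close> is smaller on one side of \<open>v\<close> and
      larger on the other, which would put it in both \<open>A\<close> and \<open>B\<close>.\<close>
    have "\<not> conflict_at G F v R Q" for v Q
      using In In' Out Out' AB(2) unfolding conflict_at_def by blast
    then show ?thesis using R X unfolding exceptional_def coherent_def by blast
  qed
  moreover have "R \<in> X" if R: "exceptional G F R" for R
  proof -
    have "route G R" using R by (simp add: exceptional_def)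
    then obtain e where e: "e \<in> set R" "e \<in> arcs G"
      using route_arcs by (metis route_def list.set_intros(1) neq_Nil_conv subsetD)
    \<comment> \<open>Any exceptional route shares an arc with a member of \<open>X\<close>, which
      is itself exceptional, and uniqueness through that arc identifies them.\<close>
    then obtain S where S: "S \<in> X" "e \<in> set S" using uniq by blast
    then have "R = S"
      using exceptional_unique_through_arc[OF framing \<open>full G\<close> R exc] e by blast
    with S show ?thesis by simp
  qed
  ultimately show ?thesis using framing by blast
qed

section \<open>The flow cone and ampleness\<close>

text \<open>Each visit to \<open>v\<close> enters and leaves it once, except that the start is not
  entered and the end is not left; the indicator terms make up for this.\<close>

lemma awalk_balance:
  assumes "awalk u p w"
  shows "length (filter (\<lambda>e. head G e = v) p) + (if u = v then 1 else 0) =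
    length (filter (\<lambda>e. tail G e = v) p) + (if w = v then 1 else 0)"
  using assms
proof (induction p arbitrary: u)
  case Nil
  then show ?case by (simp add: awalk_simps)
next
  case (Cons a p)
  then have "awalk (head G a) p w" "u = tail G a" by (simp_all add: awalk_simps)
  with Cons.IH[of "head G a"] show ?case by (simp split: if_splits)
qed

end

lemma route_vector_in_flow_cone:
  fixes G :: "('v, 'e::finite) pre_digraph"
  assumes "dag G" "route G R"
  shows "route_vector R \<in> flow_cone G"
proof -
  interpret dag G by fact
  have R: "set R \<subseteq> arcs G" using route_arcs assms(2) by blast
  have "distinct R" using route_distinct_tails[OF assms(2)] by (simp add: distinct_map)
  have balance: "(\<Sum>e \<in> in_arcs G v. route_vector R $ e) = (\<Sum>e \<in> out_arcs G v. route_vector R $ e)"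
    if "inner G v" for v
  proof -
    have "(\<Sum>e \<in> D. route_vector R $ e) = real (card (D \<inter> set R))" for D :: "'e set"
      by (simp add: route_vector_def sum.If_cases)
    moreover have "in_arcs G v \<inter> set R = set (filter (\<lambda>e. head G e = v) R)"
      "out_arcs G v \<inter> set R = set (filter (\<lambda>e. tail G e = v) R)"
      using R by auto
    moreover have "card (set (filter P R)) = length (filter P R)" for P
      using \<open>distinct R\<close> by (intro distinct_card distinct_filter)
    moreover obtain u w where "source G u" "sink G w" "awalk u R w"
      using assms(2) route_iff by blast
    \<comment> \<open>The ends of a route are not inner, so both indicator terms vanish.\<close>
    then have "length (filter (\<lambda>e. head G e = v) R) = length (filter (\<lambda>e. tail G e = v) R)"
      using awalk_balance[of u R w v] that by (auto simp: inner_def split: if_splits)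
    ultimately show ?thesis by simp
  qed
  then show ?thesis using R by (auto simp: flow_cone_def route_vector_def)
qed

text \<open>The cone is a finite intersection of hyperplanes and half-spaces. Being a polyhedron, it
  has each nonempty proper face inside a facet.\<close>

lemma polyhedron_flow_cone:
  fixes G :: "('v, 'e::finite) pre_digraph"
  assumes "fin_digraph G"
  shows "polyhedron (flow_cone G)"
proof -
  interpret fin_digraph G by fact
  \<comment> \<open>The normal vector of the conservation hyperplane at \<open>v\<close>.\<close>
  define b where "b v = (\<Sum>e \<in> in_arcs G v. axis e (1::real)) - (\<Sum>e \<in> out_arcs G v. axis e 1)"
    for v
  have "b v \<bullet> f = (\<Sum>e \<in> in_arcs G v. f $ e) - (\<Sum>e \<in> out_arcs G v. f $ e)" for v f
    by (simp add: b_def inner_diff_left inner_sum_left inner_axis')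
  then have "flow_cone G = (\<Inter>e \<in> - arcs G. {f. axis e 1 \<bullet> f = 0}) \<inter>
      (\<Inter>e \<in> arcs G. {f. axis e 1 \<bullet> f \<ge> 0}) \<inter> (\<Inter>v \<in> {v. Defs.inner G v}. {f. b v \<bullet> f = 0})"
    by (auto simp: flow_cone_def inner_axis')
  moreover have "finite {v. Defs.inner G v}"
    by (rule finite_subset[of _ "verts G"]) (auto simp: inner_def)
  ultimately show ?thesis
    by (simp only:, intro polyhedron_Int polyhedron_Inter)
      (auto intro: polyhedron_hyperplane polyhedron_halfspace_ge)
qed

text \<open>An arc missed by all exceptional routes gives a proper face, on which its coordinate
  vanishes, containing all their vectors. If no arc is missed, the mean of these vectors is positive
  on every arc, and a face containing it is the whole cone.\<close>

lemma ample_iff_exceptional_cover: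
  fixes G :: "('v, 'e::finite) pre_digraph"
  assumes "dag G"
  shows "ample G F \<longleftrightarrow> (\<forall>e \<in> arcs G. \<exists>R. exceptional G F R \<and> e \<in> set R)"
proof
  interpret dag G by fact
  have poly: "polyhedron (flow_cone G)" using polyhedron_flow_cone fin_digraph_axioms by blast
  have vec: "route_vector R \<in> flow_cone G" if "exceptional G F R" for R
    using that route_vector_in_flow_cone[OF assms] by (simp add: exceptional_def)
  {
    assume ample: "ample G F"
    show "\<forall>e \<in> arcs G. \<exists>R. exceptional G F R \<and> e \<in> set R"
    proof (rule ballI, rule ccontr)
      fix e assume e: "e \<in> arcs G" and none: "\<nexists>R. exceptional G F R \<and> e \<in> set R"
      let ?C = "flow_cone G \<inter> {f. axis e 1 \<bullet> f = 0}"
      have "?C face_of flow_cone G"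
        using face_of_Int_supporting_hyperplane_ge[OF polyhedron_imp_convex[OF poly],
            of 0 "axis e 1"] e
        by (auto simp: inner_axis' flow_cone_def)
      moreover have "0 \<in> ?C" by (simp add: flow_cone_def)
      then have "?C \<noteq> {}" by blast
      \<comment> \<open>Every arc lies on some route, whose vector shows that the face is
        proper.\<close>
      moreover obtain R where R: "route G R" "e \<in> set R" using ex_route_through_arc[OF e] by blast
      then have "route_vector R \<in> flow_cone G - ?C"
        using route_vector_in_flow_cone[OF assms] by (auto simp: inner_axis' route_vector_def)
      then have "?C \<noteq> flow_cone G" by blast
      ultimately obtain K where "K facet_of flow_cone G" "?C \<subseteq> K"
        using face_of_polyhedron_subset_facet[OF poly] by blast
      moreover have "route_vector ` {R. exceptional G F R} \<subseteq> ?C"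
        using vec none by (auto simp: inner_axis' route_vector_def)
      ultimately show False using ample unfolding ample_def by blast
    qed
  next
    assume cover: "\<forall>e \<in> arcs G. \<exists>R. exceptional G F R \<and> e \<in> set R"
    show "ample G F"
      unfolding ample_def
    proof (rule notI, elim exE conjE)
      fix K assume K: "K facet_of flow_cone G" and sub: "route_vector ` {R. exceptional G F R} \<subseteq> K"
      have face: "K face_of flow_cone G" using K facet_of_imp_face_of by blast
      let ?E = "{R. exceptional G F R}"
      have "finite ?E" by (rule finite_subset[OF _ finite_routes]) (auto simp: exceptional_def)
      have "K = flow_cone G"
      \<comment> \<open>Without arcs there is no route to average over; the cone is then a point,
        and a facet is nonempty by definition.\<close>
      proof (cases "arcs G = {}")
        case True
        then have "flow_cone G = {0}" by (auto simp: flow_cone_def vec_eq_iff)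
        then show ?thesis using K face_of_imp_subset[OF face] by (auto simp: facet_of_def)
      next
        case False
        with cover have "?E \<noteq> {}" by blast
        define m where "m = 1 / real (card ?E)"
        have "m > 0" using \<open>finite ?E\<close> \<open>?E \<noteq> {}\<close> by (simp add: m_def card_gt_0_iff)
        define x :: "real ^ 'e" where "x = (\<Sum>R \<in> ?E. m *\<^sub>R route_vector R)"
        have "(\<Sum>R \<in> ?E. m) = 1" using \<open>finite ?E\<close> \<open>?E \<noteq> {}\<close> by (simp add: m_def)
        then have "x \<in> K" unfolding x_def
          using convex_sum[OF \<open>finite ?E\<close> face_of_imp_convex[OF face], of "\<lambda>_. m" route_vector]
            sub \<open>m > 0\<close> by auto
        then have x: "x \<in> flow_cone G" using face_of_imp_subset[OF face] by blast
        have x_ge: "m \<le> x $ e" if e: "e \<in> arcs G" for e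
        proof -
          obtain R where R: "R \<in> ?E" "e \<in> set R" using cover e by blast
          have "m * route_vector R $ e \<le> (\<Sum>R \<in> ?E. m * route_vector R $ e)"
            using R(1) \<open>finite ?E\<close> \<open>m > 0\<close> by (intro member_le_sum) (auto simp: route_vector_def)
          with R show ?thesis by (simp add: x_def route_vector_def)
        qed
        have "y \<in> K" if y: "y \<in> flow_cone G" for y
        proof (cases "y = x")
          case True
          with \<open>x \<in> K\<close> show ?thesis by simp
        next
          case False
          \<comment> \<open>The segment from \<open>y\<close> to \<open>x\<close> is prolonged
            beyond \<open>x\<close> to \<open>z\<close>. Since \<open>1 + norm y\<close> is positive
            and bounds every coordinate of \<open>y\<close>, subtracting
            \<open>t *\<^sub>R y\<close> costs at most \<open>m\<close> in each coordinate, and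
            \<open>x\<close> has that much on every arc.\<close>
          define t where "t = m / (1 + norm y)"
          have "t > 0" using \<open>m > 0\<close> by (simp add: t_def add_pos_nonneg)
          define z where "z = (1 + t) *\<^sub>R x - t *\<^sub>R y"
          have "0 \<le> z $ e" if e: "e \<in> arcs G" for e
          proof -
            have "t * y $ e \<le> t * (1 + norm y)"
              using component_le_norm_cart[of y e] \<open>t > 0\<close> by (intro mult_left_mono) auto
            also have "\<dots> = m" by (simp add: t_def add_nonneg_eq_0_iff)
            also have "\<dots> \<le> x $ e" using x_ge[OF e] .
            also have "\<dots> \<le> (1 + t) * x $ e"
              using x_ge[OF e] \<open>m > 0\<close> \<open>t > 0\<close> by (simp add: algebra_simps)
            finally show ?thesis by (simp add: z_def)
          qed
          then have z: "z \<in> flow_cone G"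
            using x y unfolding flow_cone_def z_def
            by (simp add: sum_subtractf sum_distrib_left[symmetric])
          have "y \<noteq> z"
          proof
            assume "y = z"
            then have "(1 + t) *\<^sub>R (x - y) = 0" by (simp add: z_def algebra_simps)
            with False \<open>t > 0\<close> show False by simp
          qed
          moreover have "x = (1 - 1 / (1 + t)) *\<^sub>R y + (1 / (1 + t)) *\<^sub>R z"
          proof -
            have "1 - 1 / (1 + t) = t / (1 + t)" using \<open>t > 0\<close> by (simp add: field_simps)
            moreover have "(1 / (1 + t)) *\<^sub>R z = x - (t / (1 + t)) *\<^sub>R y"
              using \<open>t > 0\<close> by (simp add: z_def scaleR_diff_right)
            ultimately show ?thesis by simp
          qed
          \<comment> \<open>A face that contains a point strictly between two points of the cone
            contains both of them.\<close>
          ultimately have "x \<in> open_segment y z"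
            unfolding in_segment using \<open>t > 0\<close> by (intro conjI exI[of _ "1 / (1 + t)"]) auto
          then show ?thesis using face y z \<open>x \<in> K\<close> unfolding face_of_def by blast
        qed
        then show ?thesis using face_of_imp_subset[OF face] by blast
      qed
      with K show False by simp
    qed
  }
qed

theorem theorem3p9:
  fixes G :: "('v, 'e::finite) pre_digraph" and X :: "'e list set"
  assumes "dag G" and "full G" and "X \<subseteq> {R. route G R}"
  shows "(\<exists>F. is_framing G F \<and> ample G F \<and> {R. exceptional G F R} = X) \<longleftrightarrow>
    (\<forall>e \<in> arcs G. \<exists>!R. R \<in> X \<and> e \<in> set R) \<and> bipartite (Adj G X)"
proof
  interpret dag G by fact
  {
    assume "\<exists>F. is_framing G F \<and> ample G F \<and> {R. exceptional G F R} = X"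
    then obtain F where F: "is_framing G F" "ample G F" and X: "X = {R. exceptional G F R}" by blast
    \<comment> \<open>Existence comes from ampleness, uniqueness from
      \<open>exceptional_unique_through_arc\<close>.\<close>
    have "\<exists>!R. R \<in> X \<and> e \<in> set R" if "e \<in> arcs G" for e
      using F(2)[unfolded ample_iff_exceptional_cover[OF assms(1)]] that
        exceptional_unique_through_arc[OF F(1) assms(2)] unfolding X by blast
    then show "(\<forall>e \<in> arcs G. \<exists>!R. R \<in> X \<and> e \<in> set R) \<and> bipartite (Adj G X)"
      using bipartite_Adj_exceptional[OF F(1) assms(2)] unfolding X by blast
  next
    assume *: "(\<forall>e \<in> arcs G. \<exists>!R. R \<in> X \<and> e \<in> set R) \<and> bipartite (Adj G X)"
    then obtain F where F: "is_framing G F" "{R. exceptional G F R} = X"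
      using ex_framing_if_bipartite[OF assms(2,3)] by blast
    moreover have "ample G F"
      unfolding ample_iff_exceptional_cover[OF assms(1)] using * F(2) by blast
    ultimately show "\<exists>F. is_framing G F \<and> ample G F \<and> {R. exceptional G F R} = X" by blast
  }
qed

end
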